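(* Let $(X,d,\mu)$ be a metric measure space with a measure $\mu$ continuous with respect to $d$, let $\epsilon>0$ and let $\Omega\subset X$ be a domain with $\Gamma_\epsilon\neq\emptyset$, where $\Gamma_\epsilon=\{x\in X\setminus\Omega:\operatorname{dist}(x,\Omega)\le\epsilon\}$; put $\Omega_\epsilon=\Omega\cup\Gamma_\epsilon$. Let $g:\partial\Omega\to\mathbb{R}$ be a bounded Borel measurable function and define $F:\Gamma_\epsilon\to\mathbb{R}$ by $F=g$ on $\partial\Omega$ and $F=0$ on $\Gamma_\epsilon\setminus\partial\Omega$. Then there exists a bounded Borel function $u:\Omega_\epsilon\to\mathbb{R}$ solving the Dirichlet problem $$u(x)=\frac{1}{\mu(B(x,\epsilon))}\int_{B(x,\epsilon)}u(y)\,d\mu(y)\ \text{ for } x\in\Omega,\qquad u|_{\Gamma_\epsilon}=F.$$ In fact, $u$ is the uniform limit of the sequence $\{u_i\}_{i=0}^\infty$ defined by $u_0(x)=\inf_{\Gamma_\epsilon}F$ for $x\in\Omega$, $u_0=F$ on $\Gamma_\epsilon$, and, for $i=0,1,\ldots$, $u_{i+1}(x)=\frac{1}{\mu(B(x,\epsilon))}\int_{B(x,\epsilon)}u_i\,d\mu$ for $x\in\Omega$, $u_{i+1}=u_i$ on $\Gamma_\epsilon$.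
   Context: Standing assumptions: $\mu$ is Borel regular, $0<\mu(B)<\infty$ for every ball $B$, and $X$ is proper (closed bounded sets are compact). A domain is an open connected set. $\mu$ is continuous with respect to $d$ if $\lim_{y\to x}\mu(B(x,r)\Delta B(y,r))=0$ for all $x\in X$, $r>0$, where $\Delta$ denotes symmetric difference.
   Formalization: Uniform convergence on all of Ω_ε is claimed only for bounded Ω; for unbounded Ω only on bounded subsets of Ω_ε, since the full claim fails for X=ℝ with Lebesgue measure, ε=1, Ω=(0,∞), g(0)=−1. *)

theory Defs
  imports "HOL-Analysis.Analysis"
begin

text \<open>
  The metric space \<open>X\<close> is the universe of a type of class \<open>metric_space\<close>. A Borel regular measure is
  represented by its restriction to a \<open>\<sigma>\<close>-algebra containing the Borel sets (for instance the Borel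
  sets themselves, or all Caratheodory measurable sets), each member of which has a Borel hull of
  the same measure.
\<close>

definition borel_regular :: "'a::metric_space measure \<Rightarrow> bool" where
  "borel_regular \<mu> \<longleftrightarrow> space \<mu> = UNIV \<and> sets borel \<subseteq> sets \<mu> \<and>
     (\<forall>A\<in>sets \<mu>. \<exists>B\<in>sets borel. A \<subseteq> B \<and> emeasure \<mu> B = emeasure \<mu> A)"

definition metric_measure_space :: "'a::metric_space measure \<Rightarrow> bool" where
  "metric_measure_space \<mu> \<longleftrightarrow> borel_regular \<mu> \<and>
     (\<forall>x r. r > 0 \<longrightarrow> 0 < emeasure \<mu> (ball x r) \<and> emeasure \<mu> (ball x r) < \<infinity>) \<and>
     (\<forall>S::'a set. closed S \<and> bounded S \<longrightarrow> compact S)"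

definition continuous_wrt_metric :: "'a::metric_space measure \<Rightarrow> bool" where
  "continuous_wrt_metric \<mu> \<longleftrightarrow>
     (\<forall>x r. r > 0 \<longrightarrow> ((\<lambda>y. emeasure \<mu> (sym_diff (ball x r) (ball y r))) \<longlongrightarrow> 0) (at x))"

text \<open>
  Nonemptiness is required because \<open>infdist x {} = 0\<close> in the library, whereas the distance to the
  empty set is infinite by the usual convention.
\<close>

definition is_domain :: "'a::metric_space set \<Rightarrow> bool" where
  "is_domain \<Omega> \<longleftrightarrow> open \<Omega> \<and> connected \<Omega> \<and> \<Omega> \<noteq> {}"

definition outer_strip :: "real \<Rightarrow> 'a::metric_space set \<Rightarrow> 'a set" where
  "outer_strip \<epsilon> \<Omega> = {x. x \<notin> \<Omega> \<and> infdist x \<Omega> \<le> \<epsilon>}"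

definition extended_domain :: "real \<Rightarrow> 'a::metric_space set \<Rightarrow> 'a set" where
  "extended_domain \<epsilon> \<Omega> = \<Omega> \<union> outer_strip \<epsilon> \<Omega>"

text \<open>
  Functions on a subset of \<open>X\<close> are total functions whose values off that subset are irrelevant.
\<close>

definition borel_function_on :: "'a::metric_space set \<Rightarrow> ('a \<Rightarrow> real) \<Rightarrow> bool" where
  "borel_function_on S f \<longleftrightarrow> f \<in> borel_measurable (restrict_space borel S)"

definition zero_extension :: "'a::metric_space set \<Rightarrow> ('a \<Rightarrow> real) \<Rightarrow> 'a \<Rightarrow> real" where
  "zero_extension \<Omega> g x = (if x \<in> frontier \<Omega> then g x else 0)"

definition ball_average :: "'a::metric_space measure \<Rightarrow> real \<Rightarrow> ('a \<Rightarrow> real) \<Rightarrow> 'a \<Rightarrow> real" where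
  "ball_average \<mu> \<epsilon> f x = 1 / measure \<mu> (ball x \<epsilon>) * (LINT y:ball x \<epsilon>|\<mu>. f y)"

definition solves_dirichlet ::
    "'a::metric_space measure \<Rightarrow> real \<Rightarrow> 'a set \<Rightarrow> ('a \<Rightarrow> real) \<Rightarrow> ('a \<Rightarrow> real) \<Rightarrow> bool" where
  "solves_dirichlet \<mu> \<epsilon> \<Omega> F u \<longleftrightarrow>
     (\<forall>x\<in>\<Omega>. u x = ball_average \<mu> \<epsilon> u x) \<and> (\<forall>x\<in>outer_strip \<epsilon> \<Omega>. u x = F x)"

primrec averaging_iterates ::
    "'a::metric_space measure \<Rightarrow> real \<Rightarrow> 'a set \<Rightarrow> ('a \<Rightarrow> real) \<Rightarrow> nat \<Rightarrow> 'a \<Rightarrow> real" where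
  "averaging_iterates \<mu> \<epsilon> \<Omega> F 0 =
     (\<lambda>x. if x \<in> \<Omega> then (INF z\<in>outer_strip \<epsilon> \<Omega>. F z) else F x)"
| "averaging_iterates \<mu> \<epsilon> \<Omega> F (Suc i) =
     (\<lambda>x. if x \<in> \<Omega> then ball_average \<mu> \<epsilon> (averaging_iterates \<mu> \<epsilon> \<Omega> F i) x
          else averaging_iterates \<mu> \<epsilon> \<Omega> F i x)"

end

theory Submission
  imports Defs
begin

text \<open>
  Continuity of \<open>\<mu>\<close> makes the ball average of any bounded Borel function continuous on the whole
  space, whatever the regularity of the function. The iterates increase and are bounded, so they
  have a pointwise limit, which solves the problem by dominated convergence. Inside \<open>\<Omega>\<close> the
  iterates and their limit are restrictions of functions that are continuous also across the
  boundary of \<open>\<Omega>\<close>, so Dini's theorem on the compact closure of a bounded set yields uniform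
  convergence; outside \<open>\<Omega>\<close> the iterates are constant in \<open>i\<close>.
\<close>

section \<open>Dini's theorem and integrals over sets of finite measure\<close>

text \<open>If the sets \<open>C n\<close> where the gap to the limit is at least \<open>e\<close>
  were all nonempty, compactness would give them a common point, contradicting pointwise convergence
  there. They are closed only relative to \<open>K\<close>, since a compact set need not be closed
  without a separation axiom.\<close>

lemma Dini_incseq:
  fixes f :: "nat \<Rightarrow> 'a::topological_space \<Rightarrow> real"
  assumes "compact K" and cf: "\<And>n. continuous_on K (f n)" and ch: "continuous_on K h"
    and mono: "\<And>x. x \<in> K \<Longrightarrow> incseq (\<lambda>n. f n x)"
    and lim: "\<And>x. x \<in> K \<Longrightarrow> (\<lambda>n. f n x) \<longlonglongrightarrow> h x"
  shows "uniform_limit K f h sequentially"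
proof (rule uniform_limitI)
  fix e :: real assume "e > 0"
  define C where "C n = {x\<in>K. e \<le> h x - f n x}" for n
  have "\<exists>N. C N = {}"
  proof (rule ccontr)
    assume "\<nexists>N. C N = {}"
    moreover have "closedin (top_of_set K) (C n)" for n
    proof -
      have "closedin (top_of_set K) (K \<inter> (\<lambda>x. h x - f n x) -` {e..})"
        by (intro continuous_closedin_preimage continuous_intros cf ch closed_atLeast)
      moreover have "K \<inter> (\<lambda>x. h x - f n x) -` {e..} = C n"
        by (auto simp: C_def)
      ultimately show ?thesis by simp
    qed
    moreover have "decseq C"
      using mono unfolding decseq_def C_def incseq_def by force
    moreover have "compact_space (top_of_set K)"
      using \<open>compact K\<close> by (simp add: compact_space_subtopology)
    ultimately have "(\<Inter>n. C n) \<noteq> {}"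
      by (intro compact_space_imp_nest) auto
    then obtain x where x: "\<And>n. x \<in> C n" by auto
    then have "x \<in> K" by (auto simp: C_def)
    then have "eventually (\<lambda>n. dist (f n x) (h x) < e) sequentially"
      using lim \<open>e > 0\<close> by (auto simp: tendsto_iff)
    then obtain n where "dist (f n x) (h x) < e"
      by (meson eventually_happens trivial_limit_sequentially)
    with x[of n] show False by (auto simp: C_def dist_real_def)
  qed
  then obtain N where N: "C N = {}" by blast
  \<comment> \<open>Monotonicity only shrinks the gap after index \<open>N\<close>.\<close>
  show "\<forall>\<^sub>F n in sequentially. \<forall>x\<in>K. dist (f n x) (h x) < e"
    using eventually_ge_at_top[of N]
  proof eventually_elim
    case (elim n)
    show ?case
    proof
      fix x assume x: "x \<in> K"
      have "f n x \<le> h x"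
        using incseq_le[OF mono[OF x] lim[OF x]] .
      moreover have "f N x \<le> f n x"
        using mono[OF x] elim by (simp add: incseq_def)
      moreover have "h x - f N x < e"
        using N x by (force simp: C_def)
      ultimately show "dist (f n x) (h x) < e"
        by (simp add: dist_real_def)
    qed
  qed
qed

lemma set_integrable_bounded:
  fixes f :: "'a \<Rightarrow> real"
  assumes "f \<in> borel_measurable M" "\<And>y. \<bar>f y\<bar> \<le> C" "A \<in> sets M" "emeasure M A < \<infinity>"
  shows "set_integrable M A f"
  unfolding set_integrable_def
  using assms by (intro integrableI_bounded_set_indicator[of _ _ _ C]) auto

text \<open>The two integrands cancel on the intersection and vanish outside the union, so only the
  symmetric difference contributes, with density at most \<open>C\<close>.\<close>

lemma set_integral_abs_diff_le:
  fixes f :: "'a \<Rightarrow> real"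
  assumes f: "f \<in> borel_measurable M" "\<And>y. \<bar>f y\<bar> \<le> C"
    and A: "A \<in> sets M" "emeasure M A < \<infinity>" and B: "B \<in> sets M" "emeasure M B < \<infinity>"
  shows "\<bar>(LINT y:A|M. f y) - (LINT y:B|M. f y)\<bar> \<le> C * measure M (sym_diff A B)"
proof -
  have iA: "integrable M (\<lambda>y. indicator A y *\<^sub>R f y)"
    using set_integrable_bounded[OF f A] by (simp add: set_integrable_def)
  have iB: "integrable M (\<lambda>y. indicator B y *\<^sub>R f y)"
    using set_integrable_bounded[OF f B] by (simp add: set_integrable_def)
  have D: "sym_diff A B \<in> sets M" using A B by auto
  have "emeasure M (sym_diff A B) \<le> emeasure M (A \<union> B)"
    using A B by (intro emeasure_mono) auto
  also have "\<dots> \<le> emeasure M A + emeasure M B"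
    using A B by (intro emeasure_subadditive) auto
  also have "\<dots> < \<infinity>" using A B by simp
  finally have D': "emeasure M (sym_diff A B) < \<infinity>" .
  have iD: "integrable M (indicat_real (sym_diff A B))"
    using D D' by (simp add: integrable_indicator_iff)
  have "\<bar>(LINT y:A|M. f y) - (LINT y:B|M. f y)\<bar>
      = norm (\<integral>y. indicator A y *\<^sub>R f y - indicator B y *\<^sub>R f y \<partial>M)"
    using iA iB by (simp add: set_lebesgue_integral_def)
  also have "\<dots> \<le> (\<integral>y. C * indicat_real (sym_diff A B) y \<partial>M)"
  proof (intro order_trans[OF integral_norm_bound integral_mono])
    show "norm (indicator A y *\<^sub>R f y - indicator B y *\<^sub>R f y) \<le> C * indicat_real (sym_diff A B) y" for y
      using f(2)[of y] by (auto simp: indicator_def)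
  qed (use iA iB iD in auto)
  also have "\<dots> = C * measure M (sym_diff A B)"
    using sets.sets_into_space[OF D] by (simp add: Int_absorb2)
  finally show ?thesis .
qed

section \<open>Averages over balls\<close>

text \<open>Functions are kept Borel throughout and transferred to \<open>\<mu>\<close> only for
  integration, because \<open>sets \<mu>\<close> may be strictly larger than the Borel sets.\<close>

lemma metric_measure_space_measurable:
  assumes "metric_measure_space \<mu>" "f \<in> borel_measurable borel"
  shows "f \<in> borel_measurable \<mu>"
proof -
  have "space \<mu> = UNIV" "sets borel \<subseteq> sets \<mu>"
    using assms(1) by (auto simp: metric_measure_space_def borel_regular_def)
  then show ?thesis
    using assms(2) by (auto simp: measurable_def)
qed

lemma metric_measure_space_ball:
  fixes \<mu> :: "'a::metric_space measure"
  assumes "metric_measure_space \<mu>" "r > 0"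
  shows "ball x r \<in> sets \<mu>" "emeasure \<mu> (ball x r) < \<infinity>" "measure \<mu> (ball x r) > 0"
proof -
  show "ball x r \<in> sets \<mu>"
    using assms by (auto simp: metric_measure_space_def borel_regular_def)
  have *: "0 < emeasure \<mu> (ball x r)" "emeasure \<mu> (ball x r) < \<infinity>"
    using assms by (auto simp: metric_measure_space_def)
  then show "emeasure \<mu> (ball x r) < \<infinity>" "measure \<mu> (ball x r) > 0"
    by (auto simp: measure_def enn2real_positive_iff)
qed

lemma set_integrable_ball:
  fixes \<mu> :: "'a::metric_space measure"
  assumes "metric_measure_space \<mu>" "r > 0" "f \<in> borel_measurable borel" "\<And>y. \<bar>f y :: real\<bar> \<le> C"
  shows "set_integrable \<mu> (ball x r) f"
  using metric_measure_space_measurable[OF assms(1,3)] assms(4)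
    metric_measure_space_ball(1,2)[OF assms(1,2)]
  by (rule set_integrable_bounded)

text \<open>Moving the centre changes the integral by at most \<open>C\<close> times the measure of
  the symmetric difference of the balls, which tends to 0 by continuity of
  \<open>\<mu>\<close>.\<close>

lemma isCont_integral_ball:
  fixes \<mu> :: "'a::metric_space measure"
  assumes ms: "metric_measure_space \<mu>" and cont: "continuous_wrt_metric \<mu>" and r: "r > 0"
    and f: "f \<in> borel_measurable borel" "\<And>y. \<bar>f y :: real\<bar> \<le> C"
  shows "isCont (\<lambda>x. LINT y:ball x r|\<mu>. f y) x"
proof -
  have "((\<lambda>y. measure \<mu> (sym_diff (ball x r) (ball y r))) \<longlongrightarrow> 0) (at x)"
    using cont r tendsto_enn2real[of "\<lambda>y. emeasure \<mu> (sym_diff (ball x r) (ball y r))" 0]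
    by (auto simp: continuous_wrt_metric_def measure_def)
  then have "((\<lambda>y. C * measure \<mu> (sym_diff (ball x r) (ball y r))) \<longlongrightarrow> 0) (at x)"
    by (auto intro!: tendsto_eq_intros)
  moreover have "\<bar>(LINT z:ball x r|\<mu>. f z) - (LINT z:ball y r|\<mu>. f z)\<bar>
      \<le> C * measure \<mu> (sym_diff (ball x r) (ball y r))" for y
    using f by (intro set_integral_abs_diff_le metric_measure_space_ball[OF ms r]
        metric_measure_space_measurable[OF ms])
  ultimately have "((\<lambda>y. (LINT z:ball y r|\<mu>. f z) - (LINT z:ball x r|\<mu>. f z)) \<longlongrightarrow> 0) (at x)"
    by (rule_tac Lim_null_comparison) (auto simp: abs_minus_commute)
  then show ?thesis
    by (simp add: isCont_def LIM_zero_iff)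
qed

lemma continuous_on_ball_average:
  fixes \<mu> :: "'a::metric_space measure"
  assumes ms: "metric_measure_space \<mu>" and cont: "continuous_wrt_metric \<mu>" and r: "r > 0"
    and f: "f \<in> borel_measurable borel" "\<And>y. \<bar>f y\<bar> \<le> C"
  shows "continuous_on UNIV (ball_average \<mu> r f)"
proof -
  \<comment> \<open>The denominator of the average is the integral of 1, so the same lemma covers
    it.\<close>
  have "isCont (\<lambda>x. LINT y:ball x r|\<mu>. (1::real)) x" for x
    by (rule isCont_integral_ball[OF ms cont r, of _ 1]) auto
  moreover have "(LINT y:ball x r|\<mu>. (1::real)) = measure \<mu> (ball x r)" for x
    using metric_measure_space_ball[OF ms r, of x] by (simp add: set_integral_const)
  ultimately have "isCont (\<lambda>x. measure \<mu> (ball x r)) x" for x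
    by simp
  moreover have "measure \<mu> (ball x r) \<noteq> 0" for x
    using metric_measure_space_ball(3)[OF ms r, of x] by simp
  ultimately show ?thesis
    unfolding ball_average_def continuous_on_eq_continuous_at[OF open_UNIV]
    by (intro ballI continuous_intros isCont_integral_ball[OF ms cont r f]) auto
qed

lemma ball_average_mono:
  fixes \<mu> :: "'a::metric_space measure"
  assumes ms: "metric_measure_space \<mu>" and r: "r > 0"
    and f: "f \<in> borel_measurable borel" "\<And>y. \<bar>f y\<bar> \<le> C"
    and g: "g \<in> borel_measurable borel" "\<And>y. \<bar>g y\<bar> \<le> D"
    and le: "\<And>y. y \<in> ball x r \<Longrightarrow> f y \<le> g y"
  shows "ball_average \<mu> r f x \<le> ball_average \<mu> r g x"
  unfolding ball_average_def
proof (rule mult_left_mono)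
  show "(LINT y:ball x r|\<mu>. f y) \<le> (LINT y:ball x r|\<mu>. g y)"
    using le by (intro set_integral_mono set_integrable_ball[OF ms r f] set_integrable_ball[OF ms r g])
qed simp

lemma ball_average_const:
  fixes \<mu> :: "'a::metric_space measure"
  assumes "metric_measure_space \<mu>" "r > 0"
  shows "ball_average \<mu> r (\<lambda>_. c) x = c"
  using metric_measure_space_ball[OF assms, of x]
  by (simp add: ball_average_def set_integral_const)

text \<open>Comparison with the constants \<open>C\<close> and \<open>- C\<close>, which are their
  own averages; \<open>\<bar>C\<bar>\<close> serves as the bound that the comparison asks of
  them.\<close>

lemma abs_ball_average_le:
  fixes \<mu> :: "'a::metric_space measure"
  assumes ms: "metric_measure_space \<mu>" and r: "r > 0"
    and f: "f \<in> borel_measurable borel" "\<And>y. \<bar>f y\<bar> \<le> C"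
  shows "\<bar>ball_average \<mu> r f x\<bar> \<le> C"
proof -
  have "f y \<le> C" "- C \<le> f y" for y
    using f(2)[of y] by auto
  then show ?thesis
    using ball_average_mono[OF ms r f, of "\<lambda>_. C" "\<bar>C\<bar>" x]
      ball_average_mono[OF ms r _ _ f, of "\<lambda>_. - C" "\<bar>C\<bar>" x]
    by (simp add: ball_average_const[OF ms r] abs_le_iff)
qed

text \<open>Dominated convergence: \<open>C\<close> times the indicator of the ball is integrable
  because balls have finite measure.\<close>

lemma ball_average_tendsto:
  fixes \<mu> :: "'a::metric_space measure"
  assumes ms: "metric_measure_space \<mu>" and r: "r > 0"
    and f: "\<And>i. f i \<in> borel_measurable borel" "\<And>i y. \<bar>f i y\<bar> \<le> C"
    and h: "h \<in> borel_measurable borel"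
    and lim: "\<And>y. (\<lambda>i. f i y) \<longlonglongrightarrow> h y"
  shows "(\<lambda>i. ball_average \<mu> r (f i) x) \<longlonglongrightarrow> ball_average \<mu> r h x"
proof -
  note [measurable] = metric_measure_space_measurable[OF ms f(1)]
    metric_measure_space_measurable[OF ms h] metric_measure_space_ball(1)[OF ms r]
  have "integrable \<mu> (\<lambda>y. indicator (ball x r) y *\<^sub>R C)"
    using metric_measure_space_ball[OF ms r, of x] by auto
  then have "(\<lambda>i. LINT y:ball x r|\<mu>. f i y) \<longlonglongrightarrow> (LINT y:ball x r|\<mu>. h y)"
    unfolding set_lebesgue_integral_def
    by (intro integral_dominated_convergence[where w = "\<lambda>y. indicator (ball x r) y *\<^sub>R C"])
      (measurable, use f(2) in \<open>auto intro!: tendsto_intros lim AE_I2 simp: indicator_def\<close>)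
  then show ?thesis
    unfolding ball_average_def by (intro tendsto_intros)
qed

section \<open>Boundary data and the iterates\<close>

text \<open>Averages at points of \<open>\<Omega>\<close> thus see only values on the extended
  domain, so the arbitrary values of total functions elsewhere do no harm.\<close>

lemma ball_subset_extended_domain:
  assumes "x \<in> \<Omega>"
  shows "ball x \<epsilon> \<subseteq> extended_domain \<epsilon> \<Omega>"
proof
  fix y assume "y \<in> ball x \<epsilon>"
  then have "infdist y \<Omega> \<le> \<epsilon>"
    using infdist_le[OF assms, of y] by (simp add: dist_commute)
  then show "y \<in> extended_domain \<epsilon> \<Omega>"
    by (simp add: extended_domain_def outer_strip_def)
qed

text \<open>The frontier is closed, hence Borel, so gluing with 0 gives a Borel function on the
  whole space.\<close>

lemma zero_extension_borel:
  assumes "borel_function_on (frontier \<Omega>) g"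
  shows "zero_extension \<Omega> g \<in> borel_measurable borel"
proof -
  have "frontier \<Omega> \<inter> space borel \<in> sets borel" by auto
  then show ?thesis
    using assms unfolding borel_function_on_def zero_extension_def
    by (simp add: measurable_If_restrict_space_iff)
qed

lemma averaging_iterates_outside:
  "x \<notin> \<Omega> \<Longrightarrow> averaging_iterates \<mu> \<epsilon> \<Omega> F i x = F x"
  by (induction i) auto

text \<open>Measurability and the bound go through one induction, since continuity of the next
  average uses both. Each later iterate glues a continuous function on \<open>\<Omega>\<close> to
  \<open>F\<close> off it.\<close>

lemma averaging_iterates_bounded_borel:
  fixes \<mu> :: "'a::metric_space measure"
  assumes ms: "metric_measure_space \<mu>" and cont: "continuous_wrt_metric \<mu>" and \<epsilon>: "\<epsilon> > 0"
    and \<Omega>: "open \<Omega>" and ne: "outer_strip \<epsilon> \<Omega> \<noteq> {}"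
    and F: "F \<in> borel_measurable borel" "\<And>x. \<bar>F x\<bar> \<le> C"
  shows "averaging_iterates \<mu> \<epsilon> \<Omega> F i \<in> borel_measurable borel \<and>
    (\<forall>x. \<bar>averaging_iterates \<mu> \<epsilon> \<Omega> F i x\<bar> \<le> C)"
proof (induction i)
  case 0
  have [measurable]: "\<Omega> \<in> sets borel" using \<Omega> by simp
  \<comment> \<open>A nonempty strip makes this a genuine infimum of values in
    \<open>[-C, C]\<close>.\<close>
  have "\<bar>INF z\<in>outer_strip \<epsilon> \<Omega>. F z\<bar> \<le> C"
    using cInf_abs_ge[of "F ` outer_strip \<epsilon> \<Omega>" C] ne F(2) by auto
  then show ?case using F by simp
next
  case (Suc i)
  let ?u = "averaging_iterates \<mu> \<epsilon> \<Omega> F i"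
  have [measurable]: "\<Omega> \<in> sets borel" using \<Omega> by simp
  have [measurable]: "ball_average \<mu> \<epsilon> ?u \<in> borel_measurable borel"
    using continuous_on_ball_average[OF ms cont \<epsilon>, of ?u C] Suc
    by (intro borel_measurable_continuous_onI) auto
  show ?case
    using Suc abs_ball_average_le[OF ms \<epsilon>, of ?u C] by auto
qed

text \<open>Starting from the infimum of the data forces the first step upwards; averaging preserves
  order, which propagates the inequality.\<close>

lemma averaging_iterates_incseq:
  fixes \<mu> :: "'a::metric_space measure"
  assumes ms: "metric_measure_space \<mu>" and cont: "continuous_wrt_metric \<mu>" and \<epsilon>: "\<epsilon> > 0"
    and \<Omega>: "open \<Omega>" and ne: "outer_strip \<epsilon> \<Omega> \<noteq> {}"
    and F: "F \<in> borel_measurable borel" "\<And>x. \<bar>F x\<bar> \<le> C"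
  shows "incseq (\<lambda>i. averaging_iterates \<mu> \<epsilon> \<Omega> F i x)"
proof (rule incseq_SucI)
  fix i
  let ?u = "averaging_iterates \<mu> \<epsilon> \<Omega> F" and ?m = "INF z\<in>outer_strip \<epsilon> \<Omega>. F z"
  note u = averaging_iterates_bounded_borel[OF ms cont \<epsilon> \<Omega> ne F]
  have avg_mono: "ball_average \<mu> \<epsilon> f x \<le> ball_average \<mu> \<epsilon> (?u j) x"
    if "f \<in> borel_measurable borel" "\<And>y. \<bar>f y\<bar> \<le> D" "\<And>y. y \<in> ball x \<epsilon> \<Longrightarrow> f y \<le> ?u j y" for f D j x
    using ball_average_mono[OF ms \<epsilon> that(1,2), of "?u j" C] that(3) u by blast
  show "?u i x \<le> ?u (Suc i) x"
  proof (induction i arbitrary: x)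
    case 0
    show ?case
    proof (cases "x \<in> \<Omega>")
      case True
      have "bdd_below (F ` outer_strip \<epsilon> \<Omega>)"
        using F(2) by (intro bdd_belowI2[of _ "- C"]) (simp add: abs_le_iff minus_le_iff)
      \<comment> \<open>This can fail off the extended domain, where \<open>F\<close> may lie below
        its infimum on the strip; hence the comparison is confined to the ball.\<close>
      then have "?m \<le> ?u 0 y" if "y \<in> ball x \<epsilon>" for y
        using ball_subset_extended_domain[OF True, of \<epsilon>] that
        by (auto simp: extended_domain_def intro: cINF_lower)
      then have "ball_average \<mu> \<epsilon> (\<lambda>_. ?m) x \<le> ball_average \<mu> \<epsilon> (?u 0) x"
        by (intro avg_mono[of _ "\<bar>?m\<bar>"]) auto
      with True show ?thesis by (simp add: ball_average_const[OF ms \<epsilon>])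
    qed simp
  next
    case (Suc i)
    then have "ball_average \<mu> \<epsilon> (?u i) x \<le> ball_average \<mu> \<epsilon> (?u (Suc i)) x"
      using u by (intro avg_mono[of _ C]) auto
    then show ?case
      by (cases "x \<in> \<Omega>") (auto simp: averaging_iterates_outside)
  qed
qed

section \<open>The solution as limit of the iterates\<close>

theorem theorem6p1:
  fixes \<mu> :: "'a::metric_space measure"
    and \<epsilon> :: real
    and \<Omega> :: "'a set"
    and g :: "'a \<Rightarrow> real"
  assumes "metric_measure_space \<mu>"
    and "continuous_wrt_metric \<mu>"
    and "\<epsilon> > 0"
    and "is_domain \<Omega>"
    and "outer_strip \<epsilon> \<Omega> \<noteq> {}"
    and "bounded (g ` frontier \<Omega>)"
    and "borel_function_on (frontier \<Omega>) g"
  shows "\<exists>u :: 'a \<Rightarrow> real.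
      bounded (u ` extended_domain \<epsilon> \<Omega>) \<and>
      borel_function_on (extended_domain \<epsilon> \<Omega>) u \<and>
      solves_dirichlet \<mu> \<epsilon> \<Omega> (zero_extension \<Omega> g) u \<and>
      (bounded \<Omega> \<longrightarrow>
        uniform_limit (extended_domain \<epsilon> \<Omega>)
          (averaging_iterates \<mu> \<epsilon> \<Omega> (zero_extension \<Omega> g)) u sequentially) \<and>
      (\<forall>S. S \<subseteq> extended_domain \<epsilon> \<Omega> \<and> bounded S \<longrightarrow>
        uniform_limit S (averaging_iterates \<mu> \<epsilon> \<Omega> (zero_extension \<Omega> g)) u sequentially)"
proof -
  define F where "F = zero_extension \<Omega> g"
  define U where "U = averaging_iterates \<mu> \<epsilon> \<Omega> F"
  note ms = assms(1) and cont = assms(2) and \<epsilon> = assms(3) and ne = assms(5)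
  have \<Omega>: "open \<Omega>" using assms(4) by (simp add: is_domain_def)
  have Fm: "F \<in> borel_measurable borel"
    unfolding F_def using assms(7) by (rule zero_extension_borel)
  obtain C where C: "\<And>x. \<bar>F x\<bar> \<le> C"
  proof -
    \<comment> \<open>A positive \<open>B\<close> also bounds the value 0 taken off the
      frontier.\<close>
    obtain B where B: "B > 0" "\<And>x. x \<in> frontier \<Omega> \<Longrightarrow> \<bar>g x\<bar> \<le> B"
      using assms(6) by (auto simp: bounded_pos)
    then have "\<bar>F x\<bar> \<le> B" for x
      by (simp add: F_def zero_extension_def)
    then show ?thesis by (rule that)
  qed
  have Um: "U i \<in> borel_measurable borel" and Ub: "\<bar>U i x\<bar> \<le> C" for i x
    using averaging_iterates_bounded_borel[OF ms cont \<epsilon> \<Omega> ne Fm C] by (auto simp: U_def)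
  have Uinc: "incseq (\<lambda>i. U i x)" for x
    unfolding U_def by (rule averaging_iterates_incseq[OF ms cont \<epsilon> \<Omega> ne Fm C])
  have USuc: "U (Suc i) x = ball_average \<mu> \<epsilon> (U i) x" if "x \<in> \<Omega>" for i x
    using that by (simp add: U_def)
  have Uout: "U i x = F x" if "x \<notin> \<Omega>" for i x
    using that by (simp add: U_def averaging_iterates_outside)
  define u where "u x = lim (\<lambda>i. U i x)" for x
  have lim: "(\<lambda>i. U i x) \<longlonglongrightarrow> u x" for x
  proof -
    have "U i x \<le> C" for i using Ub[of i x] by simp
    then show ?thesis
      using incseq_convergent[OF Uinc[of x], of C] by (metis u_def limI)
  qed
  have um: "u \<in> borel_measurable borel"
    using lim Um by (rule borel_measurable_LIMSEQ_real)
  have ub: "\<bar>u x\<bar> \<le> C" for x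
    using lim[of x] Ub by (intro LIMSEQ_le_const2[OF tendsto_rabs]) auto
  have uout: "u x = F x" if "x \<notin> \<Omega>" for x
    using lim[of x] Uout[OF that] by (simp add: LIMSEQ_const_iff)
  have avg_lim: "(\<lambda>i. ball_average \<mu> \<epsilon> (U i) x) \<longlonglongrightarrow> ball_average \<mu> \<epsilon> u x" for x
    using ball_average_tendsto[OF ms \<epsilon> Um Ub um lim] .
  have uin: "u x = ball_average \<mu> \<epsilon> u x" if "x \<in> \<Omega>" for x
    \<comment> \<open>Both sides are limits of the shifted sequence
      \<open>U (Suc i) x\<close>.\<close>
    using LIMSEQ_unique[OF LIMSEQ_Suc[OF lim[of x]]] avg_lim[of x] USuc[OF that] by simp
  \<comment> \<open>Off \<open>\<Omega>\<close> every \<open>U i\<close> equals \<open>u\<close>, so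
    only the part of \<open>S\<close> inside \<open>\<Omega>\<close> must be bounded. This covers
    both the whole extended domain of a bounded \<open>\<Omega>\<close> and bounded sets
    \<open>S\<close> for general \<open>\<Omega>\<close>.\<close>
  have unif: "uniform_limit S U u sequentially" if S: "bounded (S \<inter> \<Omega>)" for S
  proof -
    have "compact (closure (S \<inter> \<Omega>))"
      using ms S by (auto simp: metric_measure_space_def intro!: bounded_closure)
    \<comment> \<open>The iterates and \<open>u\<close> may jump at the frontier, so Dini is applied
      to their averages, which are continuous on the whole space. The closure is compact because
      \<open>X\<close> is proper.\<close>
    then have "uniform_limit (closure (S \<inter> \<Omega>)) (\<lambda>i. ball_average \<mu> \<epsilon> (U i))
        (ball_average \<mu> \<epsilon> u) sequentially"
    proof (rule Dini_incseq)
      show "continuous_on (closure (S \<inter> \<Omega>)) (ball_average \<mu> \<epsilon> (U i))" for i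
        using continuous_on_ball_average[OF ms cont \<epsilon> Um Ub] by (rule continuous_on_subset) simp
      show "continuous_on (closure (S \<inter> \<Omega>)) (ball_average \<mu> \<epsilon> u)"
        using continuous_on_ball_average[OF ms cont \<epsilon> um ub] by (rule continuous_on_subset) simp
      show "incseq (\<lambda>i. ball_average \<mu> \<epsilon> (U i) x)" for x
        using Uinc by (intro incseq_SucI ball_average_mono[OF ms \<epsilon> Um Ub Um Ub]) (rule incseq_SucD)
    qed (rule avg_lim)
    then have lim_avg: "uniform_limit (S \<inter> \<Omega>) (\<lambda>i. ball_average \<mu> \<epsilon> (U i)) (ball_average \<mu> \<epsilon> u) sequentially"
      by (rule uniform_limit_on_subset) (rule closure_subset)
    \<comment> \<open>On \<open>\<Omega>\<close> the average of \<open>U i\<close> is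
      \<open>U (Suc i)\<close>, so the limit is first obtained for the shifted sequence.\<close>
    have "uniform_limit S (\<lambda>i. U (Suc i)) u sequentially"
    proof (rule uniform_limitI)
      fix e :: real assume "e > 0"
      with uniform_limitD[OF lim_avg]
      have "\<forall>\<^sub>F i in sequentially. \<forall>x\<in>S \<inter> \<Omega>. dist (ball_average \<mu> \<epsilon> (U i) x) (ball_average \<mu> \<epsilon> u x) < e" .
      then show "\<forall>\<^sub>F i in sequentially. \<forall>x\<in>S. dist (U (Suc i) x) (u x) < e"
      proof eventually_elim
        case (elim i)
        show ?case
        proof
          fix x assume "x \<in> S"
          then show "dist (U (Suc i) x) (u x) < e"
            using elim \<open>e > 0\<close> uin[of x] by (cases "x \<in> \<Omega>") (auto simp: USuc Uout uout)
        qed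
      qed
    qed
    then show ?thesis
      by (simp add: filterlim_sequentially_Suc)
  qed
  show ?thesis
  proof (intro exI[of _ u] conjI impI allI)
    show "bounded (u ` extended_domain \<epsilon> \<Omega>)"
      using ub by (auto simp: bounded_iff)
    show "borel_function_on (extended_domain \<epsilon> \<Omega>) u"
      unfolding borel_function_on_def using um by (rule measurable_restrict_space1)
    show "solves_dirichlet \<mu> \<epsilon> \<Omega> (zero_extension \<Omega> g) u"
      using uin uout by (auto simp: solves_dirichlet_def outer_strip_def F_def)
    show "uniform_limit (extended_domain \<epsilon> \<Omega>) (averaging_iterates \<mu> \<epsilon> \<Omega> (zero_extension \<Omega> g)) u sequentially"
      if "bounded \<Omega>"
      using unif that unfolding U_def F_def by (simp add: bounded_Int)
    show "uniform_limit S (averaging_iterates \<mu> \<epsilon> \<Omega> (zero_extension \<Omega> g)) u sequentially"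
      if "S \<subseteq> extended_domain \<epsilon> \<Omega> \<and> bounded S" for S
      using unif that unfolding U_def F_def by (simp add: bounded_Int)
  qed
qed

end
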